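(* Let $m,M$ be integers with $M>1$. Then: \begin{enumerate} \item If $M=p^t$ is a power of an odd prime $p$ (with $t\ge1$), then $\mathcal{A}_{2,m,M,1,1}>0$ if and only if $m\equiv\pm1\pmod p$. \item If $6\mid M$, then $\mathcal{A}_{2,m,M,1,1}<0$ if and only if $\gcd(m-1,M)=1$ or $\gcd(m+1,M)=1$. \item $\displaystyle\liminf_{X\to\infty}\frac{|\{(m,M):1\le m\le M\le X,\ \mathcal{A}_{2,m,M,1,1}>0\}|}{|\{(m,M):1\le m\le M\le X\}|}\ge\frac14$ and $\displaystyle\liminf_{X\to\infty}\frac{|\{(m,M):1\le m\le M\le X,\ \mathcal{A}_{2,m,M,1,1}<0\}|}{|\{(m,M):1\le m\le M\le X\}|}\ge\frac{1}{2\pi^2}$. \end{enumerate}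
   Context: For integers $M\ge1$, $m$, the bias $\mathcal{A}_{2,m,M,1,1}$ (the average over primes of the size-$p$ term in the expansion of the second moment $\sum_{E/\mathbb{F}_p,\,\mathrm{tr}(E)\equiv m\,(M)}\mathrm{tr}(E)^2/|\mathrm{Aut}(E)|$ of traces of Frobenius) is given by $$\mathcal{A}_{2,m,M,1,1}=\frac{1}{2\phi(M)}\Bigg(2\prod_{q\mid M}\frac{1-\delta_{q\nmid m}/(q^2-q)}{1+1/q}-\delta_{\gcd(m-1,M)=1}-\delta_{\gcd(m+1,M)=1}\Bigg),$$ the product over primes $q\mid M$, where $\delta_S=1$ if $S$ holds and $0$ otherwise, and $\phi$ is Euler's totient function. *)

theory Defs
  imports "HOL-Number_Theory.Number_Theory" "HOL-Library.Liminf_Limsup"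
    "HOL-Library.Extended_Real" Complex_Main
begin

text \<open>The bias \<open>A\<^bsub>2,m,M,1,1\<^esub>\<close> of the second moment of traces of Frobenius congruent to \<open>m\<close>
  modulo \<open>M\<close>, taken through its closed formula. It is meaningful for \<open>M \<ge> 1\<close> only;
  \<open>of_bool\<close> plays the role of the Kronecker symbol \<open>\<delta>\<close>.\<close>

definition second_moment_bias :: "int \<Rightarrow> int \<Rightarrow> real" where
  "second_moment_bias m M =
     1 / (2 * real (totient (nat M))) *
       (2 * (\<Prod>q | prime q \<and> q dvd M.
               (1 - of_bool (\<not> q dvd m) / (real_of_int q ^ 2 - real_of_int q)) /
               (1 + 1 / real_of_int q))
        - of_bool (gcd (m - 1) M = 1)
        - of_bool (gcd (m + 1) M = 1))"

end

theory Submission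
  imports Defs "HOL-Analysis.Analysis" "HOL-Real_Asymp.Real_Asymp"
begin

text \<open>
  The sign of the bias is that of twice the product of the local factors minus the number of
  signs \<open>s \<in> {1, -1}\<close> with \<open>gcd (m + s) M = 1\<close>. All local factors lie in the interval from 0 to 1.
  At an odd prime not dividing \<open>m\<close> the factor exceeds \<open>1/2\<close>, which settles prime powers. If
  \<open>6 dvd M\<close> and \<open>m\<close> is even, the factors at 2 and 3 already bring twice the product down to at
  most 1, with equality only if both signs count.

  For the densities, every pair with \<open>M\<close> even and \<open>m\<close> odd has positive bias. If \<open>M = 6 * k\<close>, then
  the residues with negative bias are the union of two translates of the units modulo \<open>M\<close>,
  whose intersection consists of multiples of 6; hence there are at least \<open>2 * totient (6 * k) - k\<close>
  of them. The crude bound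
  \<open>totient (6 * k) \<ge> 2 * k * (1 - (\<Sum>q. 1 / q))\<close>, with \<open>q\<close> ranging over the odd divisors \<open>q \<ge> 5\<close> of
  \<open>k\<close>, together with \<open>(\<Sum>q. 1 / q\<^sup>2) \<le> 1 / 8\<close>, gives the lower density \<open>1 / 18\<close>, which
  exceeds \<open>1 / (2 * pi\<^sup>2)\<close> since \<open>pi > 3\<close>; no asymptotics for the totient function are needed.
\<close>

section \<open>Local factors and the sign of the bias\<close>

definition bias_factor :: "int \<Rightarrow> int \<Rightarrow> real" where
  "bias_factor m q =
     (1 - of_bool (\<not> q dvd m) / (real_of_int q ^ 2 - real_of_int q)) / (1 + 1 / real_of_int q)"

definition bias_numerator :: "int \<Rightarrow> int \<Rightarrow> real" where
  "bias_numerator m M = 2 * (\<Prod>q | prime q \<and> q dvd M. bias_factor m q)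
     - of_bool (gcd (m - 1) M = 1) - of_bool (gcd (m + 1) M = 1)"

lemma second_moment_bias_eq:
  "second_moment_bias m M = bias_numerator m M / (2 * real (totient (nat M)))"
  by (simp add: second_moment_bias_def bias_numerator_def bias_factor_def)

lemma second_moment_bias_pos_iff:
  "M > 0 \<Longrightarrow> second_moment_bias m M > 0 \<longleftrightarrow> bias_numerator m M > 0"
  by (simp add: second_moment_bias_eq zero_less_divide_iff)

lemma second_moment_bias_neg_iff:
  "M > 0 \<Longrightarrow> second_moment_bias m M < 0 \<longleftrightarrow> bias_numerator m M < 0"
  by (simp add: second_moment_bias_eq divide_less_0_iff)

text \<open>Since \<open>q ^ 2 - q\<close> is at least 2, the correction lies in
  [0, 1), so the numerator lies in (0, 1], while the denominator exceeds 1.\<close>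

lemma bias_factor_bounds:
  assumes "prime q"
  shows "0 < bias_factor m q" "bias_factor m q < 1"
proof -
  define x where "x = real_of_int q"
  have x: "x \<ge> 2"
    using prime_ge_2_int[OF assms] by (simp add: x_def)
  have "x * (x - 1) \<ge> 2 * 1"
    using x by (intro mult_mono) auto
  then have "x ^ 2 - x \<ge> 2"
    by (simp add: power2_eq_square algebra_simps)
  then have y_bounds: "0 \<le> of_bool (\<not> q dvd m) / (x ^ 2 - x)" "of_bool (\<not> q dvd m) / (x ^ 2 - x) < 1"
    by (auto simp: divide_simps)
  define y where "y = of_bool (\<not> q dvd m) / (x ^ 2 - x)"
  have y: "0 \<le> y" "y < 1"
    using y_bounds by (simp_all only: y_def)
  have "1 / x > 0"
    using x by simp
  with y have "1 - y < 1 + 1 / x" "0 < 1 + 1 / x"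
    by linarith+
  with y show "0 < bias_factor m q" "bias_factor m q < 1"
    unfolding bias_factor_def x_def[symmetric] y_def[symmetric] by simp_all
qed

lemma finite_prime_divisors_int: "(M::int) \<noteq> 0 \<Longrightarrow> finite {q. prime q \<and> q dvd M}"
  by (rule finite_subset[OF _ finite_divisors_int]) auto

lemma bias_product_pos: "0 < (\<Prod>q | prime q \<and> q dvd M. bias_factor m q)"
  by (intro prod_pos) (auto intro: bias_factor_bounds)

text \<open>Both \<open>m - 1\<close> and \<open>m + 1\<close> share the factor 2 with
  \<open>M\<close>, so both subtracted indicators vanish and only the positive product
  remains.\<close>

lemma bias_pos_of_odd_even:
  assumes "M > 0" "even M" "odd m"
  shows "second_moment_bias m M > 0"
proof -
  have "2 dvd gcd (m - 1) M" "2 dvd gcd (m + 1) M"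
    using assms by auto
  then have "gcd (m - 1) M \<noteq> 1" "gcd (m + 1) M \<noteq> 1"
    by auto
  then show ?thesis
    using assms(1) bias_product_pos[of m M] by (simp add: second_moment_bias_pos_iff bias_numerator_def)
qed

section \<open>Powers of an odd prime\<close>

text \<open>There is a single local factor f. As \<open>p\<close> is odd, it divides at most one of
  \<open>m - 1\<close> and \<open>m + 1\<close>. If it divides one, the numerator is 2 f - 1, which
  is positive because f exceeds 1/2; if it divides neither, the numerator is 2 f - 2 < 0.\<close>

lemma bias_prime_power_pos_iff:
  fixes m p :: int
  assumes p: "prime p" "odd p" and t: "t \<ge> 1"
  shows "second_moment_bias m (p ^ t) > 0 \<longleftrightarrow> [m = 1] (mod p) \<or> [m = -1] (mod p)"
proof -
  have p3: "p \<ge> 3"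
    using prime_ge_2_int[OF p(1)] p(2) by (cases "p = 2") auto
  have gcd_iff: "gcd a (p ^ t) = 1 \<longleftrightarrow> \<not> p dvd a" for a
  proof -
    have "coprime a p \<longleftrightarrow> \<not> p dvd a"
      using p(1) prime_imp_coprime[of p a] coprime_common_divisor[of a p p]
      by (auto simp: coprime_commute not_prime_unit)
    then show ?thesis
      using t by (simp add: coprime_iff_gcd_eq_1[symmetric])
  qed
  have primes: "{q. prime q \<and> q dvd p ^ t} = {p}"
    using p(1) t primes_dvd_imp_eq[of _ p] by (auto dest: prime_dvd_power)
  have num: "bias_numerator m (p ^ t) =
      2 * bias_factor m p - of_bool (\<not> p dvd m - 1) - of_bool (\<not> p dvd m + 1)"
    unfolding bias_numerator_def primes gcd_iff by simp
  have cong: "[m = 1] (mod p) \<longleftrightarrow> p dvd m - 1" "[m = -1] (mod p) \<longleftrightarrow> p dvd m + 1"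
    by (simp_all add: cong_iff_dvd_diff)
  show ?thesis
  proof (cases "p dvd m - 1 \<or> p dvd m + 1")
    case True
    have "\<not> (p dvd m - 1 \<and> p dvd m + 1)"
    proof
      assume "p dvd m - 1 \<and> p dvd m + 1"
      then have "p dvd (m + 1) - (m - 1)" using dvd_diff by blast
      then have "p dvd 2" by simp
      with p3 show False by (auto dest: zdvd_imp_le)
    qed
    moreover have "\<not> p dvd m"
    proof
      assume "p dvd m"
      with True have "p dvd m - (m - 1) \<or> p dvd (m + 1) - m"
        using dvd_diff by blast
      then have "p dvd 1" by simp
      with p3 show False by (auto dest: zdvd_imp_le)
    qed
    then have "2 * bias_factor m p > 1"
    proof -
      define x where "x = real_of_int p"
      have x: "x \<ge> 3" using p3 by (simp add: x_def)
      \<comment> \<open>The factor simplifies to (x^2 - x - 1) / (x^2 - 1), so f > 1/2 amounts to x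
        (x - 2) > 1.\<close>
      have "x * (x - 2) \<ge> 3 * 1"
        using x by (intro mult_mono) auto
      then have *: "2 * (x\<^sup>2 - x - 1) > x\<^sup>2 - 1"
        by (simp add: power2_eq_square algebra_simps)
      have "bias_factor m p = (x\<^sup>2 - x - 1) / (x\<^sup>2 - 1)"
        using \<open>\<not> p dvd m\<close> x unfolding bias_factor_def x_def[symmetric]
        by (simp add: power2_eq_square square_eq_1_iff divide_simps) (simp add: algebra_simps)
      moreover have "x\<^sup>2 - 1 > 0"
        using x by (simp add: power2_eq_square less_1_mult)
      ultimately have "1 / 2 < bias_factor m p"
        using * by (simp only: less_divide_eq if_True) simp
      then show ?thesis by simp
    qed
    ultimately show ?thesis
      using True p3 unfolding cong by (subst second_moment_bias_pos_iff) (auto simp: num)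
  next
    case False
    then show ?thesis
      using p3 bias_factor_bounds(2)[OF p(1), of m] unfolding cong
      by (subst second_moment_bias_pos_iff) (auto simp: num)
  qed
qed

section \<open>Moduli divisible by 6\<close>

lemma bias_six_dvd_neg_iff:
  fixes m M :: int
  assumes "M > 0" "6 dvd M"
  shows "second_moment_bias m M < 0 \<longleftrightarrow> gcd (m - 1) M = 1 \<or> gcd (m + 1) M = 1"
proof (cases "gcd (m - 1) M = 1 \<or> gcd (m + 1) M = 1")
  case False
  then show ?thesis
    using assms(1) bias_product_pos[of m M]
    by (simp add: second_moment_bias_neg_iff bias_numerator_def)
next
  case True
  define F where "F = {q. prime q \<and> q dvd M}"
  define R where "R = (\<Prod>q\<in>F - {2} - {3}. bias_factor m q)"
  have finF: "finite F"
    unfolding F_def using assms(1) by (intro finite_prime_divisors_int) auto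
  have "2 dvd M" "3 dvd M"
    using assms(2) by (auto elim!: dvd_trans[rotated])
  then have mem: "2 \<in> F" "3 \<in> F - {2}"
    by (auto simp: F_def)
  have prod_eq: "(\<Prod>q\<in>F. bias_factor m q) = bias_factor m 2 * (bias_factor m 3 * R)"
    unfolding R_def using finF mem by (simp add: prod.remove[of F 2] prod.remove[of "F - {2}" 3])
  have R: "0 < R" "R \<le> 1"
    unfolding R_def F_def
    by (auto intro!: prod_pos prod_le_1 bias_factor_bounds intro: less_imp_le[OF bias_factor_bounds(1)]
        less_imp_le[OF bias_factor_bounds(2)])
  have "even m"
  proof (rule ccontr)
    assume "odd m"
    then have "2 dvd gcd (m - 1) M" "2 dvd gcd (m + 1) M"
      using \<open>2 dvd M\<close> by auto
    with True show False by auto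
  qed
  then have f2: "bias_factor m 2 = 2 / 3"
    by (simp add: bias_factor_def)
  have f3: "bias_factor m 3 = (if 3 dvd m then 3 / 4 else 5 / 8)"
    by (simp add: bias_factor_def)
  \<comment> \<open>Twice the factors at 2 and 3 is 2 * 2/3 * 5/8 = 5/6 if 3 does not divide
    \<open>m\<close>, already below the one indicator at hand. If 3 divides \<open>m\<close> it is
    exactly 1, and strictness comes either from a further prime, making \<open>R < 1\<close>, or
    from the second indicator.\<close>
  consider "gcd (m - 1) M = 1" "gcd (m + 1) M = 1" | "\<not> 3 dvd m"
    | "3 dvd m" "\<exists>q. q \<in> F - {2} - {3}"
  proof (cases "3 dvd m \<and> F - {2} - {3} = {}")
    case True
    \<comment> \<open>Here 2 and 3 are the only primes dividing \<open>M\<close>, and both divide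
      \<open>m\<close>; a prime common to \<open>a\<close> and \<open>M\<close> would divide
      \<open>m - a\<close>, which is 1 or -1.\<close>
    have "gcd a M = 1" if a: "a = m - 1 \<or> a = m + 1" for a
    proof (rule ccontr)
      assume "gcd a M \<noteq> 1"
      then obtain q where q: "prime q" "q dvd gcd a M"
        using prime_divisor_exists[of "gcd a M"] assms(1) by (auto simp: is_unit_gcd_iff)
      with True have "q = 2 \<or> q = 3"
        by (auto simp: F_def)
      with True \<open>even m\<close> have "q dvd m" by auto
      moreover have "q dvd a" using q by simp
      ultimately have "q dvd m - a" by (rule dvd_diff)
      with a have "q dvd 1" by auto
      with q(1) show False using not_prime_unit by blast
    qed
    then show ?thesis using that by blast
  qed (use that in blast)
  then have "bias_numerator m M < 0"
  proof cases
    case 1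
    then show ?thesis
      using prod_eq R f2 f3 by (auto simp: bias_numerator_def F_def split: if_splits)
  next
    case 2
    then show ?thesis
      using True prod_eq R f2 f3 by (auto simp: bias_numerator_def F_def split: if_splits)
  next
    case 3
    then obtain q where q: "q \<in> F - {2} - {3}" by blast
    have "R = bias_factor m q * (\<Prod>r\<in>F - {2} - {3} - {q}. bias_factor m r)"
      unfolding R_def using q finF by (intro prod.remove) auto
    also have "\<dots> \<le> bias_factor m q * 1"
      using q by (intro mult_left_mono prod_le_1)
        (auto simp: F_def intro: less_imp_le[OF bias_factor_bounds(1)]
          less_imp_le[OF bias_factor_bounds(2)])
    also have "\<dots> < 1"
      using q bias_factor_bounds(2)[of q m] by (simp add: F_def)
    finally show ?thesis
      using True 3(1) prod_eq f2 f3 by (auto simp: bias_numerator_def F_def)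
  qed
  then show ?thesis
    using True assms(1) by (simp add: second_moment_bias_neg_iff)
qed

section \<open>Counting pairs and lower densities\<close>

text \<open>Slicing by the modulus turns the real cutoff into a natural one. For
  \<open>X < 1\<close> both sides are 0.\<close>

lemma card_pairs_eq_sum:
  fixes P :: "int \<Rightarrow> int \<Rightarrow> bool" and X :: real
  shows "card {(k::int, N::int). 1 \<le> k \<and> k \<le> N \<and> real_of_int N \<le> X \<and> P k N} =
    (\<Sum>N=1..nat \<lfloor>X\<rfloor>. card {k \<in> {1..int N}. P k (int N)})"
proof -
  let ?S = "SIGMA N:{1..nat \<lfloor>X\<rfloor>}. {k \<in> {1..int N}. P k (int N)}"
  let ?f = "\<lambda>(N, k). (k, int N)"
  have "{(k::int, N::int). 1 \<le> k \<and> k \<le> N \<and> real_of_int N \<le> X \<and> P k N} = ?f ` ?S"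
  proof (intro equalityI subsetI)
    fix z assume "z \<in> {(k::int, N::int). 1 \<le> k \<and> k \<le> N \<and> real_of_int N \<le> X \<and> P k N}"
    then obtain k N where z: "z = (k, N)" "1 \<le> k" "k \<le> N" "real_of_int N \<le> X" "P k N"
      by auto
    then have "(nat N, k) \<in> ?S"
      by (auto simp: le_floor_iff nat_le_iff)
    moreover have "z = ?f (nat N, k)"
      using z by auto
    ultimately show "z \<in> ?f ` ?S" by (rule rev_image_eqI)
  next
    have "real N \<le> X" if "N \<ge> 1" "N \<le> nat \<lfloor>X\<rfloor>" for N
      using that by linarith
    then show "z \<in> {(k::int, N::int). 1 \<le> k \<and> k \<le> N \<and> real_of_int N \<le> X \<and> P k N}"
      if "z \<in> ?f ` ?S" for z
      using that by auto
  qed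
  moreover have "inj_on ?f ?S"
    by (auto simp: inj_on_def)
  ultimately have "card {(k::int, N::int). 1 \<le> k \<and> k \<le> N \<and> real_of_int N \<le> X \<and> P k N} = card ?S"
    by (simp only: card_image)
  moreover have "finite {k \<in> {1..int N}. P k (int N)}" for N
    by (rule finite_subset[of _ "{1..int N}"]) auto
  then have "card ?S = (\<Sum>N=1..nat \<lfloor>X\<rfloor>. card {k \<in> {1..int N}. P k (int N)})"
    by (intro card_SigmaI ballI) simp_all
  ultimately show ?thesis by simp
qed

text \<open>There are n (n + 1) / 2 pairs in total, hence the doubling of \<open>a\<close>; the
  linear error \<open>b * real n\<close> disappears in the limit.\<close>

lemma Liminf_density_ge:
  fixes P :: "int \<Rightarrow> int \<Rightarrow> bool" and a b :: real
  assumes "\<And>n. a * real n ^ 2 - b * real n \<le>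
    real (\<Sum>N=1..n. card {k \<in> {1..int N}. P k (int N)})"
  shows "ereal (2 * a) \<le> Liminf at_top (\<lambda>X::real. ereal (
     real (card {(k::int, N::int). 1 \<le> k \<and> k \<le> N \<and> real_of_int N \<le> X \<and> P k N}) /
     real (card {(k::int, N::int). 1 \<le> k \<and> k \<le> N \<and> real_of_int N \<le> X})))"
proof -
  define g where "g n = (a * real n ^ 2 - b * real n) / (real n * (real n + 1) / 2)" for n
  have "g \<longlonglongrightarrow> 2 * a"
    unfolding g_def by real_asymp
  moreover have "filterlim (\<lambda>X::real. nat \<lfloor>X\<rfloor>) at_top at_top"
    by (intro filterlim_compose[OF filterlim_nat_sequentially filterlim_floor_sequentially])
  ultimately have "((\<lambda>X::real. g (nat \<lfloor>X\<rfloor>)) \<longlongrightarrow> 2 * a) at_top"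
    by (rule filterlim_compose)
  then have "((\<lambda>X::real. ereal (g (nat \<lfloor>X\<rfloor>))) \<longlongrightarrow> ereal (2 * a)) at_top"
    by simp
  then have "ereal (2 * a) = Liminf at_top (\<lambda>X::real. ereal (g (nat \<lfloor>X\<rfloor>)))"
    by (intro lim_imp_Liminf[symmetric]) auto
  also have "\<dots> \<le> Liminf at_top (\<lambda>X::real. ereal (
     real (card {(k::int, N::int). 1 \<le> k \<and> k \<le> N \<and> real_of_int N \<le> X \<and> P k N}) /
     real (card {(k::int, N::int). 1 \<le> k \<and> k \<le> N \<and> real_of_int N \<le> X})))"
  proof (intro Liminf_mono always_eventually allI)
    \<comment> \<open>For \<open>X < 1\<close> both quotients have denominator 0 and hence value 0,
      so the comparison holds for every \<open>X\<close>.\<close>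
    fix X :: real
    define n where "n = nat \<lfloor>X\<rfloor>"
    have "{k \<in> {1..int N}. True} = {1..int N}" for N
      by blast
    then have "real (card {(k::int, N::int). 1 \<le> k \<and> k \<le> N \<and> real_of_int N \<le> X}) =
        real (\<Sum>N=1..n. N)"
      using card_pairs_eq_sum[of X "\<lambda>_ _. True"] by (simp only: n_def simp_thms) simp
    also have "\<dots> = real n * (real n + 1) / 2"
      using double_gauss_sum_from_Suc_0[of n, where ?'a = real] by simp
    finally have total: "real (card {(k::int, N::int). 1 \<le> k \<and> k \<le> N \<and> real_of_int N \<le> X}) =
        real n * (real n + 1) / 2" .
    show "ereal (g (nat \<lfloor>X\<rfloor>)) \<le> ereal (
     real (card {(k::int, N::int). 1 \<le> k \<and> k \<le> N \<and> real_of_int N \<le> X \<and> P k N}) /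
     real (card {(k::int, N::int). 1 \<le> k \<and> k \<le> N \<and> real_of_int N \<le> X}))"
      unfolding card_pairs_eq_sum[of X P] total g_def n_def[symmetric] ereal_less_eq
      by (intro divide_right_mono assms) simp
  qed
  finally show ?thesis .
qed

section \<open>Sums over multiples\<close>

lemma multiples_image:
  fixes d n :: nat
  assumes "d > 0"
  shows "{k \<in> {1..n}. d dvd k} = (\<lambda>j. d * j) ` {1..n div d}"
  using assms by (auto simp: less_eq_div_iff_mult_less_eq mult.commute elim!: dvdE)

lemma sum_multiples:
  fixes d n :: nat and f :: "nat \<Rightarrow> 'a::comm_monoid_add"
  assumes "d > 0"
  shows "(\<Sum>k | k \<in> {1..n} \<and> d dvd k. f k) = (\<Sum>j=1..n div d. f (d * j))"
proof -
  have "inj_on (\<lambda>j. d * j) {1..n div d}"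
    using assms by (auto simp: inj_on_def)
  then show ?thesis
    using multiples_image[OF assms, of n] by (simp add: sum.reindex)
qed

lemma sum_multiples_le:
  fixes d n :: nat and f :: "nat \<Rightarrow> nat"
  assumes "d > 0"
  shows "(\<Sum>j=1..n div d. f (d * j)) \<le> (\<Sum>k=1..n. f k)"
  unfolding sum_multiples[OF assms, symmetric] by (rule sum_mono2) auto

section \<open>Density of positive bias\<close>

lemma card_bias_pos_even_ge:
  "j \<le> card {k \<in> {1..int (2 * j)}. second_moment_bias k (int (2 * j)) > 0}"
proof -
  have "j = card ((\<lambda>i. 2 * int i + 1) ` {..<j})"
    by (subst card_image) (auto simp: inj_on_def)
  also have "\<dots> \<le> card {k \<in> {1..int (2 * j)}. second_moment_bias k (int (2 * j)) > 0}"
  proof (rule card_mono)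
    show "finite {k \<in> {1..int (2 * j)}. second_moment_bias k (int (2 * j)) > 0}"
      by (rule finite_subset[of _ "{1..int (2 * j)}"]) auto
  qed (auto intro!: bias_pos_of_odd_even)
  finally show ?thesis .
qed

text \<open>Each even modulus 2 j contributes at least its j odd residues. Summing over j up to n/2
  gives about n^2 / 8, that is, density 1/4.\<close>

lemma sum_card_bias_pos_ge:
  "1 / 8 * real n ^ 2 - 1 / 8 * real n \<le>
     real (\<Sum>N=1..n. card {k \<in> {1..int N}. second_moment_bias k (int N) > 0})"
proof -
  define h where "h = n div 2"
  have "n \<le> 2 * h + 1"
    unfolding h_def by presburger
  then have h: "real h \<ge> (real n - 1) / 2"
    using of_nat_mono[of n "2 * h + 1", where ?'a = real] by simp
  have "1 / 8 * real n ^ 2 - 1 / 8 * real n \<le> real h * (real h + 1) / 2"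
  proof (cases "n = 0")
    case False
    \<comment> \<open>The left side is (n^2 - 1) / 4, and n^2 - 1 is at least n^2 - n for n at least
      1.\<close>
    have "(real n - 1) / 2 * ((real n - 1) / 2 + 1) \<le> real h * (real h + 1)"
      using h False by (intro mult_mono) auto
    moreover have "1 * 1 \<le> real n"
      using False by simp
    ultimately show ?thesis by (simp add: power2_eq_square field_simps)
  qed auto
  also have "\<dots> = (\<Sum>j=1..h. real j)"
    using double_gauss_sum_from_Suc_0[of h, where ?'a = real] by simp
  also have "\<dots> \<le>
      (\<Sum>j=1..h. real (card {k \<in> {1..int (2 * j)}. second_moment_bias k (int (2 * j)) > 0}))"
    by (intro sum_mono of_nat_mono card_bias_pos_even_ge)
  also have "\<dots> \<le> real (\<Sum>N=1..n. card {k \<in> {1..int N}. second_moment_bias k (int N) > 0})"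
    using sum_multiples_le[of 2 "\<lambda>N. card {k \<in> {1..int N}. second_moment_bias k (int N) > 0}" n]
    unfolding h_def of_nat_sum[symmetric] of_nat_le_iff by simp
  finally show ?thesis .
qed

section \<open>Density of negative bias\<close>

text \<open>Inclusion-exclusion for \<open>A\<close> and \<open>B\<close>, each of size at least the
  totient. The overlap bound \<open>k\<close> is added on the right to avoid truncated
  subtraction.\<close>

lemma card_bias_neg_ge:
  assumes "k > 0"
  shows "2 * totient (6 * k) \<le>
    card {m \<in> {1..int (6 * k)}. second_moment_bias m (int (6 * k)) < 0} + k"
proof -
  define M where "M = int (6 * k)"
  define T where "T = totatives (6 * k)"
  define A where "A = {m \<in> {1..M}. gcd (m - 1) M = 1}"
  define B where "B = {m \<in> {1..M}. gcd (m + 1) M = 1}"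
  have finAB: "finite A" "finite B"
    unfolding A_def B_def by (rule finite_subset[of _ "{1..M}"]; auto)+
  have T: "finite T" "card T = totient (6 * k)"
    by (simp_all add: T_def totient_def)
  have T_D: "1 \<le> t \<and> int t < M \<and> gcd (int t) M = 1" if "t \<in> T" for t
  proof -
    \<comment> \<open>The strict bound \<open>int t < M\<close> keeps the translate
      \<open>int t + 1\<close> inside \<open>{1..M}\<close>.\<close>
    have "t \<noteq> 6 * k" using that assms by (auto simp: T_def totatives_def)
    moreover have "gcd t (6 * k) = 1"
      using that by (intro coprime_imp_gcd_eq_1) (simp add: T_def totatives_def)
    then have "gcd (int t) M = 1"
      unfolding M_def by (metis gcd_int_int_eq of_nat_1)
    ultimately show ?thesis using that by (auto simp: T_def M_def totatives_def)
  qed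
  have "card T = card ((\<lambda>t. int t + 1) ` T)"
    by (subst card_image) (auto simp: inj_on_def)
  also have "\<dots> \<le> card A"
    using finAB(1) by (rule card_mono) (auto simp: A_def dest!: T_D)
  finally have cA: "totient (6 * k) \<le> card A" using T by simp
  \<comment> \<open>The translate of 1 would be 0, outside the range; its representative
    \<open>M\<close> takes its place and differs from all other translates.\<close>
  have "card T = card ((\<lambda>t. if t = 1 then M else int t - 1) ` T)"
  proof (rule card_image[symmetric], rule inj_onI)
    fix s t assume "s \<in> T" "t \<in> T"
      and "(if s = 1 then M else int s - 1) = (if t = 1 then M else int t - 1)"
    then show "s = t"
      using T_D[of s] T_D[of t] by (auto split: if_splits)
  qed
  also have "\<dots> \<le> card B"
    using finAB(2)
  proof (rule card_mono, intro image_subsetI)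
    fix t assume "t \<in> T"
    moreover have "gcd (M + 1) M = 1"
      using gcd_add1[of 1 M] by (simp add: add.commute)
    moreover have "M \<ge> 1"
      using assms by (simp add: M_def)
    ultimately show "(if t = 1 then M else int t - 1) \<in> B"
      using T_D[of t] by (auto simp: B_def)
  qed
  finally have cB: "totient (6 * k) \<le> card B" using T by simp
  have "A \<inter> B \<subseteq> (\<lambda>j. 6 * int j) ` {1..k}"
  proof
    fix m assume m: "m \<in> A \<inter> B"
    have nd: "\<not> r dvd m - 1 \<and> \<not> r dvd m + 1" if "r dvd M" "\<not> is_unit r" for r
    proof -
      have "gcd (m - 1) M = 1" "gcd (m + 1) M = 1"
        using m by (simp_all add: A_def B_def)
      then show ?thesis
        using that gcd_greatest[of r "m - 1" M] gcd_greatest[of r "m + 1" M] by auto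
    qed
    \<comment> \<open>So \<open>m\<close> is even and congruent to neither 1 nor -1 modulo
      3.\<close>
    have "\<not> 2 dvd m - 1" "\<not> 3 dvd m - 1" "\<not> 3 dvd m + 1"
      using nd[of 2] nd[of 3] by (auto simp: M_def)
    then have "6 dvd m" by presburger
    then obtain i where i: "m = 6 * i" ..
    then show "m \<in> (\<lambda>j. 6 * int j) ` {1..k}"
      using m by (intro image_eqI[of _ _ "nat i"]) (auto simp: A_def M_def)
  qed
  then have "card (A \<inter> B) \<le> card ((\<lambda>j. 6 * int j) ` {1..k})"
    by (intro card_mono) auto
  also have "\<dots> \<le> k"
    using card_image_le[of "{1..k}" "\<lambda>j. 6 * int j"] by simp
  finally have cAB: "card (A \<inter> B) \<le> k" .
  have "{m \<in> {1..M}. second_moment_bias m M < 0} = A \<union> B"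
    using assms by (auto simp: A_def B_def M_def bias_six_dvd_neg_iff)
  then show ?thesis
    using cA cB cAB card_Un_Int[OF finAB] by (simp add: M_def)
qed

text \<open>Euler's product with the primes 2 and 3 split off gives the factor 6 k * 1/2 * 2/3 = 2
  k, and the Weierstrass inequality bounds the rest. Passing from primes to all odd divisors of
  \<open>k\<close> from 5 on only enlarges the sum. The bound \<open>K\<close>, independent of
  \<open>k\<close>, allows the later interchange of sums.\<close>

lemma totient_six_mult_ge:
  assumes "k > 0" "k \<le> K"
  shows "real (totient (6 * k)) \<ge>
    2 * real k - 2 * real k * (\<Sum>i | i \<in> {2..K} \<and> (2 * i + 1) dvd k. 1 / real (2 * i + 1))"
proof -
  define P where "P = prime_factors (6 * k) - {2} - {3}"
  define I where "I = {i. i \<in> {2..K} \<and> (2 * i + 1) dvd k}"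
  have mem: "2 \<in> prime_factors (6 * k)" "3 \<in> prime_factors (6 * k) - {2}"
    using assms by (auto simp: in_prime_factors_iff dvd_mult2)
  have "P \<subseteq> (\<lambda>i. 2 * i + 1) ` I"
  proof
    fix p assume "p \<in> P"
    then have p: "prime p" "p dvd 6 * k" "p \<noteq> 2" "p \<noteq> 3"
      by (auto simp: P_def in_prime_factors_iff)
    have "p \<noteq> 4" using p(1) by auto
    then have "p \<ge> 5" using p(3,4) prime_ge_2_nat[OF p(1)] by linarith
    have "odd p" using p(1) \<open>p \<ge> 5\<close> by (intro prime_odd_nat) auto
    then obtain i where i: "p = 2 * i + 1" by (elim oddE)
    have "coprime p 2" "coprime p 3"
      using p by (intro primes_coprime; simp)+
    then have "coprime p (2 * 3)" by (subst coprime_mult_right_iff) simp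
    then have "p dvd k" using p(2) by (simp add: coprime_dvd_mult_right_iff)
    moreover from this have "p \<le> k" using assms by (simp add: dvd_imp_le)
    ultimately have "i \<in> I" using i \<open>p \<ge> 5\<close> assms by (auto simp: I_def)
    with i show "p \<in> (\<lambda>i. 2 * i + 1) ` I" by blast
  qed
  then have "(\<Sum>p\<in>P. 1 / real p) \<le> (\<Sum>p\<in>(\<lambda>i. 2 * i + 1) ` I. 1 / real p)"
    by (intro sum_mono2) (auto simp: I_def)
  also have "\<dots> = (\<Sum>i\<in>I. 1 / real (2 * i + 1))"
    by (subst sum.reindex) (auto simp: inj_on_def)
  finally have sum_le: "(\<Sum>p\<in>P. 1 / real p) \<le> (\<Sum>i\<in>I. 1 / real (2 * i + 1))" .
  have "1 - (\<Sum>p\<in>P. 1 / real p) \<le> (\<Prod>p\<in>P. 1 - 1 / real p)"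
    by (intro Weierstrass_prod_ineq)
      (auto simp: P_def in_prime_factors_iff divide_simps dest: prime_gt_0_nat)
  then have "2 * real k * (1 - (\<Sum>i\<in>I. 1 / real (2 * i + 1))) \<le>
      2 * real k * (\<Prod>p\<in>P. 1 - 1 / real p)"
    using sum_le by (intro mult_left_mono) auto
  also have "\<dots> = real (totient (6 * k))"
    unfolding totient_formula2 P_def
    using mem by (simp add: prod.remove[of "prime_factors (6 * k)" 2]
        prod.remove[of "prime_factors (6 * k) - {2}" 3])
  finally show ?thesis by (simp add: I_def algebra_simps)
qed

lemma sum_inverse_odd_squares_le:
  "(\<Sum>i=2..n. 1 / real (2 * i + 1) ^ 2) \<le> 1 / 8"
proof -
  \<comment> \<open>The sharper bound telescopes, because (2 x + 3)^2 = 4 (x + 1) (x + 2) + 1; it is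
    an equality at \<open>n = 1\<close>, where the sum is empty.\<close>
  have "(\<Sum>i=2..n. 1 / real (2 * i + 1) ^ 2) \<le> 1 / 8 - 1 / (4 * (real n + 1))" if "n \<ge> 1" for n
    using that
  proof (induction n rule: nat_induct_at_least)
    case (Suc n)
    define x where "x = real n"
    have x: "x \<ge> 1" using Suc by (simp add: x_def)
    have "1 / real (2 * Suc n + 1) ^ 2 = 1 / (2 * x + 3) ^ 2"
      by (simp add: x_def algebra_simps)
    also have "\<dots> \<le> 1 / (4 * (x + 1) * (x + 2))"
      using x by (intro divide_left_mono mult_pos_pos) (auto simp: power2_eq_square algebra_simps intro: add_pos_nonneg)
    also have "\<dots> = 1 / (4 * (x + 1)) - 1 / (4 * (x + 2))"
      using x by (simp add: divide_simps)
    finally show ?case using Suc by (simp add: x_def algebra_simps)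
  qed auto
  moreover have "1 / 8 - 1 / (4 * (real n + 1)) \<le> 1 / 8"
    by simp
  ultimately show ?thesis
    by (cases "n \<ge> 1") (blast intro: order_trans, simp)
qed

text \<open>After interchanging the sums, each odd q contributes 1 + ... + J with J = K div q, at
  most (K / q)^2; the sum of the inverse squares is at most 1/8.\<close>

lemma sum_weighted_odd_divisors_le:
  "(\<Sum>k=1..K. real k * (\<Sum>i | i \<in> {2..K} \<and> (2 * i + 1) dvd k. 1 / real (2 * i + 1)))
     \<le> real K ^ 2 / 8"
proof -
  have "(\<Sum>k=1..K. real k * (\<Sum>i | i \<in> {2..K} \<and> (2 * i + 1) dvd k. 1 / real (2 * i + 1))) =
      (\<Sum>k=1..K. \<Sum>i | i \<in> {2..K} \<and> (2 * i + 1) dvd k. real k / real (2 * i + 1))"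
    by (simp add: sum_distrib_left)
  also have "\<dots> = (\<Sum>i=2..K. \<Sum>k | k \<in> {1..K} \<and> (2 * i + 1) dvd k. real k / real (2 * i + 1))"
    by (rule sum.swap_restrict) auto
  also have "\<dots> \<le> (\<Sum>i=2..K. real K ^ 2 * (1 / real (2 * i + 1) ^ 2))"
  proof (rule sum_mono)
    fix i :: nat
    define q where "q = 2 * i + 1"
    define J where "J = K div q"
    have q: "q > 0" by (simp add: q_def)
    have "(\<Sum>k | k \<in> {1..K} \<and> q dvd k. real k / real q) = (\<Sum>j=1..J. real j)"
      unfolding sum_multiples[OF q] J_def using q by simp
    also have "\<dots> = real J * (real J + 1) / 2"
      using double_gauss_sum_from_Suc_0[of J, where ?'a = real] by simp
    \<comment> \<open>Bounding by J^2 loses a factor of about 2 but leaves no linear error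
      term.\<close>
    also have "\<dots> \<le> real J ^ 2"
      by (cases "J = 0") (auto simp: power2_eq_square field_simps)
    also have "\<dots> \<le> (real K / real q) ^ 2"
      unfolding J_def by (intro power_mono) (auto simp: of_nat_div_le_of_nat)
    finally show "(\<Sum>k | k \<in> {1..K} \<and> (2 * i + 1) dvd k. real k / real (2 * i + 1)) \<le>
        real K ^ 2 * (1 / real (2 * i + 1) ^ 2)"
      by (simp add: q_def power_divide)
  qed
  also have "\<dots> \<le> real K ^ 2 * (1 / 8)"
    unfolding sum_distrib_left[symmetric]
    by (intro mult_left_mono sum_inverse_odd_squares_le) auto
  finally show ?thesis by simp
qed

text \<open>The modulus 6 k contributes at least 2 (2 k - 2 k S) - k = 3 k - 4 k S. Summed up to K,
  this is at least 3 K (K + 1) / 2 - K^2 / 2, hence at least K^2, where K is about n / 6.\<close>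

lemma sum_card_bias_neg_ge:
  "1 / 36 * real n ^ 2 - 10 / 36 * real n \<le>
     real (\<Sum>N=1..n. card {m \<in> {1..int N}. second_moment_bias m (int N) < 0})"
proof -
  define K where "K = n div 6"
  define c where "c N = card {m \<in> {1..int N}. second_moment_bias m (int N) < 0}" for N
  define S where "S k = (\<Sum>i | i \<in> {2..K} \<and> (2 * i + 1) dvd k. 1 / real (2 * i + 1))" for k
  have "n \<le> 6 * K + 5"
    unfolding K_def by presburger
  then have K: "real K \<ge> (real n - 5) / 6"
    using of_nat_mono[of n "6 * K + 5", where ?'a = real] by simp
  \<comment> \<open>The constants come from ((n - 5) / 6)^2 = (n^2 - 10 n + 25) / 36; for n < 5 the
    left side is at most 0.\<close>
  have "1 / 36 * real n ^ 2 - 10 / 36 * real n \<le> real K ^ 2"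
  proof (cases "n \<ge> 5")
    case True
    then have "((real n - 5) / 6) ^ 2 \<le> real K ^ 2"
      using K by (intro power_mono) auto
    then show ?thesis by (simp add: power2_eq_square field_simps)
  next
    case False
    then have "real n * real n \<le> 10 * real n"
      by (intro mult_right_mono) auto
    then have "1 / 36 * real n ^ 2 - 10 / 36 * real n \<le> 0"
      by (simp add: power2_eq_square)
    then show ?thesis by (rule order_trans) simp
  qed
  also have "\<dots> \<le> 3 * (real K * (real K + 1) / 2) - 4 * (real K ^ 2 / 8)"
    by (simp add: power2_eq_square field_simps)
  also have "\<dots> \<le> 3 * (\<Sum>k=1..K. real k) - 4 * (\<Sum>k=1..K. real k * S k)"
    using double_gauss_sum_from_Suc_0[of K, where ?'a = real] sum_weighted_odd_divisors_le[of K]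
    by (simp add: S_def)
  also have "\<dots> = (\<Sum>k=1..K. 3 * real k - 4 * (real k * S k))"
    by (simp add: sum_subtractf sum_distrib_left)
  also have "\<dots> \<le> (\<Sum>k=1..K. real (c (6 * k)))"
  proof (rule sum_mono)
    fix k assume "k \<in> {1..K}"
    then have k: "k > 0" "k \<le> K" by auto
    show "3 * real k - 4 * (real k * S k) \<le> real (c (6 * k))"
      using totient_six_mult_ge[OF k] card_bias_neg_ge[OF k(1)]
      unfolding S_def[symmetric] c_def[symmetric] by linarith
  qed
  also have "\<dots> \<le> real (\<Sum>N=1..n. c N)"
    using sum_multiples_le[of 6 c n] unfolding K_def of_nat_sum[symmetric] of_nat_le_iff by simp
  finally show ?thesis by (simp add: c_def)
qed

theorem theorem3p2:
  fixes m M :: int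
  assumes "M > 1"
  shows
    "(\<forall>(p::int) (t::nat). prime p \<and> odd p \<and> t \<ge> 1 \<and> M = p ^ t \<longrightarrow>
        (second_moment_bias m M > 0 \<longleftrightarrow> [m = 1] (mod p) \<or> [m = -1] (mod p))) \<and>
     (6 dvd M \<longrightarrow>
        (second_moment_bias m M < 0 \<longleftrightarrow> gcd (m - 1) M = 1 \<or> gcd (m + 1) M = 1)) \<and>
     Liminf at_top (\<lambda>X::real. ereal (
         real (card {(k::int, N::int). 1 \<le> k \<and> k \<le> N \<and> real_of_int N \<le> X \<and> second_moment_bias k N > 0}) /
         real (card {(k::int, N::int). 1 \<le> k \<and> k \<le> N \<and> real_of_int N \<le> X})))
       \<ge> ereal (1 / 4) \<and>
     Liminf at_top (\<lambda>X::real. ereal (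
         real (card {(k::int, N::int). 1 \<le> k \<and> k \<le> N \<and> real_of_int N \<le> X \<and> second_moment_bias k N < 0}) /
         real (card {(k::int, N::int). 1 \<le> k \<and> k \<le> N \<and> real_of_int N \<le> X})))
       \<ge> ereal (1 / (2 * pi\<^sup>2))"
proof (intro conjI allI impI)
  fix p :: int and t :: nat
  assume "prime p \<and> odd p \<and> t \<ge> 1 \<and> M = p ^ t"
  then show "second_moment_bias m M > 0 \<longleftrightarrow> [m = 1] (mod p) \<or> [m = -1] (mod p)"
    using bias_prime_power_pos_iff by blast
next
  assume "6 dvd M"
  with assms show "second_moment_bias m M < 0 \<longleftrightarrow> gcd (m - 1) M = 1 \<or> gcd (m + 1) M = 1"
    by (intro bias_six_dvd_neg_iff) auto
next
  show "ereal (1 / 4) \<le> Liminf at_top (\<lambda>X::real. ereal (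
     real (card {(k::int, N::int). 1 \<le> k \<and> k \<le> N \<and> real_of_int N \<le> X \<and> second_moment_bias k N > 0}) /
     real (card {(k::int, N::int). 1 \<le> k \<and> k \<le> N \<and> real_of_int N \<le> X})))"
    using Liminf_density_ge[OF sum_card_bias_pos_ge] by simp
next
  have "3 ^ 2 \<le> pi ^ 2"
    using pi_gt3 by (intro power_mono) auto
  then have "ereal (1 / (2 * pi\<^sup>2)) \<le> ereal (2 * (1 / 36))"
    by (simp add: divide_simps)
  also have "\<dots> \<le> Liminf at_top (\<lambda>X::real. ereal (
     real (card {(k::int, N::int). 1 \<le> k \<and> k \<le> N \<and> real_of_int N \<le> X \<and> second_moment_bias k N < 0}) /
     real (card {(k::int, N::int). 1 \<le> k \<and> k \<le> N \<and> real_of_int N \<le> X})))"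
    by (rule Liminf_density_ge[OF sum_card_bias_neg_ge])
  finally show "ereal (1 / (2 * pi\<^sup>2)) \<le> Liminf at_top (\<lambda>X::real. ereal (
     real (card {(k::int, N::int). 1 \<le> k \<and> k \<le> N \<and> real_of_int N \<le> X \<and> second_moment_bias k N < 0}) /
     real (card {(k::int, N::int). 1 \<le> k \<and> k \<le> N \<and> real_of_int N \<le> X})))" .
qed

end
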